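(* For $n\geq2$, let $$D_n=1\oplus(-2I_{n-1})\in\mathbb{R}^{n\times n},\qquad \mathcal{U}_n=\left\{X\in\mathbb{R}^{n\times n}:\|X-D_n\|_F<\frac14\right\}.$$ Then every $X\in\mathcal{U}_n$ is unstable (i.e. not stable) and, for every unitarily invariant norm $\nu$ on $\mathbb{C}^{n\times n}$, it holds $$d_{\mathbb{R},\nu}(X)=d_{\mathbb{C},\nu}(X)=c_\nu\,\sigma_{\min}(X).$$ In addition, for almost every $X\in\mathcal{U}_n$ (with respect to Lebesgue measure on $\mathbb{R}^{n\times n}$), the stable matrix in $\mathbb{C}^{n\times n}$ nearest to $X$ in the Frobenius norm is unique.
   Context: A matrix $X\in\mathbb{C}^{n\times n}$ is called (Hurwitz) stable if all its eigenvalues lie in the closed left half-plane $\{z\in\mathbb{C}:\Re z\le 0\}$. Let $\mathcal{E}\subset\mathbb{C}^{n\times n}$ be the set of stable matrices. A norm $\nu$ on $\mathbb{C}^{n\times n}$ is unitarily invariant if $\nu(UXV)=\nu(X)$ for all $X$ and all unitary $U,V$. For such $\nu$ set $c_\nu=\nu(e_1e_1^T)$, where $e_1$ is the first standard basis vector. For $A\in\mathbb{R}^{n\times n}$ define $d_{\mathbb{C},\nu}(A)=\min_{X\in\mathcal{E}}\nu(A-X)$ and $d_{\mathbb{R},\nu}(A)=\min_{X\in\mathcal{E}\cap\mathbb{R}^{n\times n}}\nu(A-X)$. $\sigma_{\min}(X)$ is the smallest singular value of $X$, $\|\cdot\|_F$ is the Frobenius norm, and $\oplus$ is the block diagonal direct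 sum. *)

theory Defs
  imports "HOL-Analysis.Analysis"
begin

text \<open>
  Square matrices of order \<open>n = CARD('n)\<close> are elements of \<open>complex ^ 'n ^ 'n\<close> and
  \<open>real ^ 'n ^ 'n\<close>. A finite index type carries no order, so the index playing the role of
  the first one is an explicit parameter \<open>k\<close>; \<open>axis k 1\<close> is then the first standard
  basis vector.

  The library norm on matrices, being the Euclidean norm of the vector of Euclidean norms
  of the rows, is the Frobenius norm.
\<close>

lemma norm_matrix_eq_frobenius:
  fixes A :: "'a::real_normed_vector ^ 'm ^ 'n"
  shows "norm A = sqrt (\<Sum>i\<in>UNIV. \<Sum>j\<in>UNIV. (norm (A $ i $ j))\<^sup>2)"
  by (simp add: norm_vec_def L2_set_def sum_nonneg)

definition cmatrix :: "real ^ 'm ^ 'n \<Rightarrow> complex ^ 'm ^ 'n" where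
  "cmatrix A = (\<chi> i j. complex_of_real (A $ i $ j))"

definition conj_transpose :: "complex ^ 'm ^ 'n \<Rightarrow> complex ^ 'n ^ 'm" where
  "conj_transpose A = (\<chi> i j. cnj (A $ j $ i))"

definition unitary :: "complex ^ 'n ^ 'n \<Rightarrow> bool" where
  "unitary U \<longleftrightarrow> conj_transpose U ** U = mat 1 \<and> U ** conj_transpose U = mat 1"

definition eigenvalue :: "complex ^ 'n ^ 'n \<Rightarrow> complex \<Rightarrow> bool" where
  "eigenvalue A z \<longleftrightarrow> (\<exists>v. v \<noteq> 0 \<and> A *v v = z *s v)"

definition hurwitz_stable :: "complex ^ 'n ^ 'n \<Rightarrow> bool" where
  "hurwitz_stable A \<longleftrightarrow> (\<forall>z. eigenvalue A z \<longrightarrow> Re z \<le> 0)"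

definition stable_matrices :: "(complex ^ 'n ^ 'n) set" where
  "stable_matrices = {A. hurwitz_stable A}"

definition real_matrices :: "(complex ^ 'n ^ 'n) set" where
  "real_matrices = range cmatrix"

definition singular_values :: "complex ^ 'n ^ 'n \<Rightarrow> real set" where
  "singular_values A =
     sqrt ` {t. eigenvalue (conj_transpose A ** A) (complex_of_real t)}"

definition sigma_min :: "complex ^ 'n ^ 'n \<Rightarrow> real" where
  "sigma_min A = Min (singular_values A)"

definition matrix_norm :: "(complex ^ 'n ^ 'n \<Rightarrow> real) \<Rightarrow> bool" where
  "matrix_norm \<nu> \<longleftrightarrow>
     (\<forall>A. 0 \<le> \<nu> A) \<and>
     (\<forall>A. \<nu> A = 0 \<longleftrightarrow> A = 0) \<and>
     (\<forall>c A. \<nu> (\<chi> i j. c * A $ i $ j) = cmod c * \<nu> A) \<and>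
     (\<forall>A B. \<nu> (A + B) \<le> \<nu> A + \<nu> B)"

definition unitarily_invariant_norm :: "(complex ^ 'n ^ 'n \<Rightarrow> real) \<Rightarrow> bool" where
  "unitarily_invariant_norm \<nu> \<longleftrightarrow>
     matrix_norm \<nu> \<and> (\<forall>A U V. unitary U \<longrightarrow> unitary V \<longrightarrow> \<nu> (U ** A ** V) = \<nu> A)"

definition c_norm :: "'n \<Rightarrow> (complex ^ 'n ^ 'n \<Rightarrow> real) \<Rightarrow> real" where
  "c_norm k \<nu> = \<nu> (\<chi> i j. axis k 1 $ i * axis k 1 $ j)"

text \<open>
  The distances are minima. They are written as infima here; wherever they are used, that
  the infimum is attained is asserted separately, by the following predicate.
\<close>

definition min_attained :: "('a \<Rightarrow> real) \<Rightarrow> 'a set \<Rightarrow> bool" where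
  "min_attained f S \<longleftrightarrow> (\<exists>x\<in>S. \<forall>y\<in>S. f x \<le> f y)"

definition dist_complex :: "(complex ^ 'n ^ 'n \<Rightarrow> real) \<Rightarrow> real ^ 'n ^ 'n \<Rightarrow> real" where
  "dist_complex \<nu> A = (INF X\<in>stable_matrices. \<nu> (cmatrix A - X))"

definition dist_real :: "(complex ^ 'n ^ 'n \<Rightarrow> real) \<Rightarrow> real ^ 'n ^ 'n \<Rightarrow> real" where
  "dist_real \<nu> A = (INF X\<in>stable_matrices \<inter> real_matrices. \<nu> (cmatrix A - X))"

definition D_matrix :: "'n \<Rightarrow> real ^ 'n ^ 'n" where
  "D_matrix k = (\<chi> i j. if i = j then (if i = k then 1 else - 2) else 0)"

definition U_ball :: "'n \<Rightarrow> (real ^ 'n ^ 'n) set" where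
  "U_ball k = {X. norm (X - D_matrix k) < 1 / 4}"

definition frobenius_nearest_stable :: "complex ^ 'n ^ 'n \<Rightarrow> complex ^ 'n ^ 'n \<Rightarrow> bool" where
  "frobenius_nearest_stable A Y \<longleftrightarrow>
     Y \<in> stable_matrices \<and> (\<forall>Z\<in>stable_matrices. norm (A - Y) \<le> norm (A - Z))"

end

theory Submission
  imports Defs "HOL-Complex_Analysis.Complex_Analysis"
begin

text \<open>
  Write \<open>X = D + E\<close>, let \<open>v\<close> be a real unit vector minimising \<open>\<sigma> = |X v|\<close>. Since \<open>D\<close> stretches
  \<open>e\<^sub>k\<close> by 1 and \<open>e\<^sub>k\<^sup>\<bottom>\<close> by 2, \<open>v\<close> is close to \<open>\<plusminus>e\<^sub>k\<close>, and on \<open>v\<^sup>\<bottom>\<close> the form \<open>|X r|\<^sup>2\<close> exceeds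
  \<open>\<sigma>\<^sup>2 |r|\<^sup>2\<close> by a gap while \<open>r \<bullet> X r\<close> is negative. The second fact makes the rank one correction
  \<open>X - (X v) v\<^sup>T\<close>, whose distance to \<open>X\<close> is \<open>c\<^sub>\<nu> \<sigma>\<close>, stable.

  Conversely, a segment from an unstable to a stable matrix meets a matrix \<open>Z\<close> with an eigenvalue
  \<open>i \<omega>\<close> on the imaginary axis, because stability is a closed condition (Hurwitz's theorem). If
  \<open>x\<close> is a unit eigenvector of \<open>Z\<close>, then \<open>(X - Z) x = (X - i \<omega>) x\<close>. In \<open>|(X - i \<omega>) x|\<^sup>2\<close> the only
  indefinite term is \<open>\<omega>\<close> times the skew form of \<open>E - E\<^sup>T\<close>; that form vanishes on the real line of
  \<open>v\<close>, so the gap absorbs it and \<open>|(X - i \<omega>) x| \<ge> \<sigma>\<close>, with equality only for \<open>\<omega> = 0\<close> and \<open>x\<close> a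
  multiple of \<open>v\<close>. The equality case gives uniqueness in the Frobenius norm for every matrix of the
  ball, not only for almost every one.
\<close>

unbundle no Formal_Power_Series.fps_syntax

section \<open>Closedness of the set of stable matrices\<close>

text \<open>Cauchy-Schwarz on each row: the Frobenius norm dominates the operator norm.\<close>

lemma norm_matrix_vector_mult_le:
  fixes A :: "'a::real_normed_field ^ 'm ^ 'n"
  shows "norm (A *v x) \<le> norm A * norm x"
proof -
  have "norm ((A *v x) $ i) \<le> norm (A $ i) * norm x" for i
  proof -
    have "norm ((A *v x) $ i) \<le> (\<Sum>j\<in>UNIV. norm (A $ i $ j) * norm (x $ j))"
      unfolding matrix_vector_mult_def by (simp add: sum_norm_le norm_mult)
    also have "\<dots> \<le> L2_set (\<lambda>j. norm (A $ i $ j)) UNIV * L2_set (\<lambda>j. norm (x $ j)) UNIV"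
      using L2_set_mult_ineq[of "\<lambda>j. norm (A $ i $ j)" "\<lambda>j. norm (x $ j)" UNIV] by simp
    finally show ?thesis by (simp add: norm_vec_def)
  qed
  then have "norm (A *v x) \<le> L2_set (\<lambda>i. norm (A $ i) * norm x) UNIV"
    unfolding norm_vec_def[of "A *v x"] by (intro L2_set_mono) auto
  also have "\<dots> = norm A * norm x"
    by (simp add: norm_vec_def[of A] L2_set_left_distrib)
  finally show ?thesis .
qed

lemma scaleR_matrix_vector_mult:
  fixes A :: "'a::real_algebra_1 ^ 'm ^ 'n"
  shows "(r *\<^sub>R A) *v x = r *\<^sub>R (A *v x)"
  by (simp add: vec_eq_iff matrix_vector_mult_def scaleR_right.sum)

lemma matrix_vector_mult_scaleR_right:
  fixes A :: "'a::real_algebra_1 ^ 'm ^ 'n"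
  shows "A *v (r *\<^sub>R x) = r *\<^sub>R (A *v x)"
  by (simp add: vec_eq_iff matrix_vector_mult_def scaleR_right.sum)

lemma norm_vector_scalar_mult:
  fixes x :: "'a::real_normed_field ^ 'n"
  shows "norm (c *s x) = norm c * norm x"
  by (simp add: norm_vec_def norm_mult L2_set_right_distrib)

lemma scalar_mult_eq_scaleR:
  fixes x :: "complex ^ 'n"
  shows "complex_of_real r *s x = r *\<^sub>R x"
  unfolding vec_eq_iff by (simp del: of_real_eq_iff add: scaleR_conv_of_real[where 'a=complex])

lemma scaleR_scalar_mult:
  fixes x :: "complex ^ 'n"
  shows "r *\<^sub>R (z *s x) = z *s (r *\<^sub>R x)"
  by (simp add: vec_eq_iff scaleR_conv_of_real)

lemma eigenvalue_norm_le:
  assumes "eigenvalue A z"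
  shows "norm z \<le> norm A"
proof -
  obtain v where v: "v \<noteq> 0" "A *v v = z *s v"
    using assms by (auto simp: eigenvalue_def)
  then have "norm z * norm v \<le> norm A * norm v"
    using norm_matrix_vector_mult_le[of A v] by (simp add: norm_vector_scalar_mult)
  then show ?thesis using v(1) by simp
qed

lemma eigenvalue_unit_vector:
  assumes "eigenvalue A z"
  obtains v where "norm v = 1" "A *v v = z *s v"
proof -
  obtain v where v: "v \<noteq> 0" "A *v v = z *s v"
    using assms by (auto simp: eigenvalue_def)
  show ?thesis
    by (rule that[of "inverse (norm v) *\<^sub>R v"])
       (use v in \<open>auto simp: matrix_vector_mult_scaleR_right scaleR_scalar_mult\<close>)
qed

text \<open>The determinant is holomorphic in \<open>z\<close> and jointly continuous in
  \<open>z\<close> and the matrix, which is the form Hurwitz's theorem asks for.\<close>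

lemma eigenvalue_iff_det: "eigenvalue A z \<longleftrightarrow> det (mat z - A) = 0"
proof -
  have *: "(mat z - A) *v v = 0 \<longleftrightarrow> A *v v = z *s v" for v
  proof -
    have "mat z *v v = z *s v"
      by (simp add: vec_eq_iff matrix_vector_mult_def mat_def if_distrib if_distribR cong: if_cong)
    then show ?thesis by (auto simp: matrix_vector_mult_diff_rdistrib)
  qed
  have "det (mat z - A) = 0 \<longleftrightarrow> \<not> (\<forall>v. (mat z - A) *v v = 0 \<longrightarrow> v = 0)"
    by (metis invertible_det_nz matrix_left_invertible_ker invertible_left_inverse)
  then show ?thesis unfolding eigenvalue_def * by blast
qed

text \<open>The characteristic polynomials of a convergent sequence converge locally uniformly on
  the open right half-plane. If none of them vanishes there, Hurwitz's theorem says that the limit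
  does not either, provided it is not constant.\<close>

lemma closed_stable_matrices: "closed (stable_matrices :: (complex ^ 'n ^ 'n) set)"
  unfolding closed_sequential_limits
proof (intro allI impI, elim conjE)
  fix F :: "nat \<Rightarrow> complex ^ 'n ^ 'n" and A
  assume F: "\<forall>n. F n \<in> stable_matrices" and lim: "F \<longlonglongrightarrow> A"
  define S where "S = {z. Re z > 0}"
  define h where "h = (\<lambda>p :: (complex ^ 'n ^ 'n) \<times> complex. det (mat (snd p) - fst p))"
  have cont: "continuous_on T h" for T
  proof -
    have "continuous_on T (\<lambda>p. (mat (snd p) - fst p :: complex ^ 'n ^ 'n) $ i $ j)" for i j
      by (cases "i = j") (auto simp: mat_def intro!: continuous_intros)
    then show ?thesis unfolding h_def det_def
      by (intro continuous_on_sum continuous_on_mult continuous_on_const continuous_on_prod)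
  qed
  have hol: "(\<lambda>z. h (B, z)) holomorphic_on S" for B
  proof -
    have "(\<lambda>z. (mat z - B) $ i $ j) holomorphic_on S" for i j
      by (cases "i = j") (auto simp: mat_def intro!: holomorphic_intros)
    then show ?thesis unfolding h_def det_def fst_conv snd_conv
      by (intro holomorphic_on_sum holomorphic_on_mult holomorphic_on_const holomorphic_on_prod)
  qed
  have ev: "h (B, z) = 0 \<longleftrightarrow> eigenvalue B z" for B z
    by (simp add: h_def eigenvalue_iff_det)
  have "Re z \<le> 0" if z: "eigenvalue A z" for z
  proof (rule ccontr)
    assume "\<not> Re z \<le> 0"
    then have zS: "z \<in> S" by (simp add: S_def)
    have "h (A, z) \<noteq> 0"
    proof (rule Hurwitz_no_zeros[of S "\<lambda>n z. h (F n, z)" "\<lambda>z. h (A, z)"])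
      show "open S" unfolding S_def by (rule open_halfspace_Re_gt)
      show "connected S" unfolding S_def
        by (intro convex_connected convex_halfspace_Re_gt)
      show "\<And>n z. z \<in> S \<Longrightarrow> h (F n, z) \<noteq> 0"
        using F by (force simp: ev S_def stable_matrices_def hurwitz_stable_def)
      \<comment> \<open>A constant value would be 0, the value at the eigenvalue \<open>z\<close>.
        Then \<open>norm A + 1\<close> would be an eigenvalue too, beyond the bound
        \<open>norm A\<close>.\<close>
      show "\<not> (\<lambda>z. h (A, z)) constant_on S"
      proof
        assume "(\<lambda>z. h (A, z)) constant_on S"
        moreover have "complex_of_real (norm A + 1) \<in> S"
          by (simp add: S_def add_nonneg_pos)
        ultimately have "h (A, complex_of_real (norm A + 1)) = h (A, z)"
          using zS unfolding constant_on_def by metis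
        then have "eigenvalue A (complex_of_real (norm A + 1))"
          using z by (simp only: ev[symmetric])
        from eigenvalue_norm_le[OF this] show False by (simp del: of_real_add)
      qed
      show "uniform_limit K (\<lambda>n z. h (F n, z)) (\<lambda>z. h (A, z)) sequentially"
        if K: "compact K" for K
      proof (rule uniform_limitI)
        fix e :: real assume "e > 0"
        \<comment> \<open>\<open>F n\<close> eventually enters the unit ball around
          \<open>A\<close>, so uniform continuity of \<open>h\<close> on this compact product
          controls all points of \<open>K\<close> at once.\<close>
        have "compact (cball A 1 \<times> K)" using K by (simp add: compact_Times)
        then have "uniformly_continuous_on (cball A 1 \<times> K) h"
          using cont compact_uniformly_continuous by blast
        then obtain d where d: "d > 0"
          "\<And>p q. p \<in> cball A 1 \<times> K \<Longrightarrow> q \<in> cball A 1 \<times> K \<Longrightarrow> dist q p < d \<Longrightarrow> dist (h q) (h p) < e"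
          using \<open>e > 0\<close> unfolding uniformly_continuous_on_def by metis
        have "\<forall>\<^sub>F n in sequentially. dist (F n) A < min d 1"
          using lim d(1) by (intro tendstoD) auto
        then show "\<forall>\<^sub>F n in sequentially. \<forall>z\<in>K. dist (h (F n, z)) (h (A, z)) < e"
          by eventually_elim (auto intro!: d(2) simp: dist_Pair_Pair dist_commute)
      qed
    qed (use hol zS in auto)
    then show False using z by (simp add: ev)
  qed
  then show "A \<in> stable_matrices" by (auto simp: stable_matrices_def hurwitz_stable_def)
qed

text \<open>No eigenvalue is followed along the segment. The parameters of stable matrices and the
  parameters of matrices with an eigenvalue in the closed right half-plane form two closed sets that
  cover \<open>{0..1}\<close>; both are nonempty, so by connectedness they meet. At a common
  parameter that eigenvalue has real part 0.\<close>

lemma unstable_stable_segment: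
  fixes A B :: "complex ^ 'n ^ 'n"
  assumes A: "\<not> hurwitz_stable A" and B: "hurwitz_stable B"
  obtains t \<omega> x where "0 < t" "t \<le> 1" "norm x = 1"
    "(A + t *\<^sub>R (B - A)) *v x = (\<i> * complex_of_real \<omega>) *s x"
proof -
  define M where "M = (\<lambda>t :: real. A + t *\<^sub>R (B - A))"
  define S where "S = {t \<in> {0..1}. hurwitz_stable (M t)}"
  define T where "T = {t \<in> {0..1}. \<exists>z. Re z \<ge> 0 \<and> eigenvalue (M t) z}"
  have contM: "continuous_on I M" for I
    unfolding M_def by (intro continuous_intros)
  have "S = {0..1} \<inter> M -` stable_matrices"
    by (auto simp: S_def stable_matrices_def)
  then have clS: "closed S"
    using continuous_closed_preimage[OF contM _ closed_stable_matrices] by simp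
  have clT: "closed T"
  proof -
    \<comment> \<open>\<open>R\<close> bounds every eigenvalue along the segment, so
      \<open>T\<close> is the projection of a compact set of triples (parameter, eigenvalue, unit
      eigenvector).\<close>
    define R where "R = norm A + norm (B - A)"
    define P where "P = ({0..1} \<times> cball (0 :: complex) R \<times> sphere (0 :: complex ^ 'n) 1)
      \<inter> {p. Re (fst (snd p)) \<ge> 0 \<and> (\<forall>i. (\<Sum>j\<in>UNIV. M (fst p) $ i $ j * snd (snd p) $ j) = fst (snd p) * snd (snd p) $ i)}"
    have "compact P"
      unfolding P_def M_def
      by (intro compact_Int_closed compact_Times closed_Collect_conj closed_Collect_all
          closed_Collect_le closed_Collect_eq continuous_intros) auto
    then have "compact (fst ` P)"
      by (intro compact_continuous_image continuous_intros)
    moreover have "T = fst ` P"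
    proof
      show "T \<subseteq> fst ` P"
      proof
        fix t assume "t \<in> T"
        then obtain z where t: "t \<in> {0..1}" and z: "Re z \<ge> 0" "eigenvalue (M t) z"
          by (auto simp: T_def)
        then obtain x where x: "norm x = 1" "M t *v x = z *s x"
          using eigenvalue_unit_vector by metis
        have "norm (M t) \<le> norm A + norm (t *\<^sub>R (B - A))"
          unfolding M_def by (rule norm_triangle_ineq)
        also have "\<dots> \<le> R" using t by (auto simp: R_def intro: mult_left_le_one_le)
        finally have "norm z \<le> R" using eigenvalue_norm_le[OF z(2)] by simp
        moreover have "(\<Sum>j\<in>UNIV. M t $ i $ j * x $ j) = z * x $ i" for i
          using arg_cong[OF x(2), of "\<lambda>y. y $ i"] by (simp add: matrix_vector_mult_def)
        ultimately have "(t, z, x) \<in> P" using t z x(1) by (simp add: P_def)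
        then show "t \<in> fst ` P" by force
      qed
      show "fst ` P \<subseteq> T"
      proof
        fix t assume "t \<in> fst ` P"
        then obtain z x where P: "(t, z, x) \<in> P" by force
        then have "M t *v x = z *s x" "norm x = 1"
          by (auto simp: P_def vec_eq_iff matrix_vector_mult_def)
        then have "eigenvalue (M t) z" unfolding eigenvalue_def by (metis norm_zero zero_neq_one)
        then show "t \<in> T" using P by (auto simp: T_def P_def)
      qed
    qed
    ultimately show ?thesis by (simp add: compact_imp_closed)
  qed
  have "1 \<in> S" "0 \<notin> S" using A B by (auto simp: S_def M_def)
  have cover: "{0..1} \<subseteq> S \<union> T"
    by (auto simp: S_def T_def hurwitz_stable_def) (meson less_imp_le not_le)
  then have "0 \<in> T" using \<open>0 \<notin> S\<close> by force
  have "S \<inter> T \<inter> {0..1} \<noteq> {}"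
  proof
    assume "S \<inter> T \<inter> {0..1} = {}"
    moreover have "connected {0..1::real}" by simp
    ultimately have "S \<inter> {0..1} = {} \<or> T \<inter> {0..1} = {}"
      using clS clT cover unfolding connected_closed by blast
    then show False using \<open>1 \<in> S\<close> \<open>0 \<in> T\<close> by auto
  qed
  then obtain t where "t \<in> S" "t \<in> T" by auto
  then obtain z where t: "0 \<le> t" "t \<le> 1" "hurwitz_stable (M t)" and z: "Re z \<ge> 0" "eigenvalue (M t) z"
    by (auto simp: S_def T_def)
  then have "Re z = 0" by (auto simp: hurwitz_stable_def)
  then have zz: "z = \<i> * complex_of_real (Im z)" by (simp add: complex_eq_iff)
  have "t \<noteq> 0" using \<open>t \<in> S\<close> \<open>0 \<notin> S\<close> by auto
  moreover obtain x where "norm x = 1" "M t *v x = z *s x"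
    using eigenvalue_unit_vector[OF z(2)] by metis
  ultimately show ?thesis using that[of t x "Im z"] t zz by (simp add: M_def)
qed

section \<open>Unitarily invariant norms\<close>

lemma matrix_mult_diff_left: "(A - B) ** C = A ** C - B ** (C :: 'a::ring_1 ^ 'p ^ 'm)"
  by (simp add: vec_eq_iff matrix_matrix_mult_def sum_subtractf left_diff_distrib)

lemma matrix_mult_diff_right: "A ** (B - C) = A ** B - (A :: 'a::ring_1 ^ 'm ^ 'n) ** C"
  by (simp add: vec_eq_iff matrix_matrix_mult_def sum_subtractf right_diff_distrib)

lemma matrix_mult_scaleR:
  fixes A :: "'a::real_algebra_1 ^ 'm ^ 'n"
  shows "(r *\<^sub>R A) ** B = r *\<^sub>R (A ** B)" "A ** (r *\<^sub>R B) = r *\<^sub>R (A ** B)"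
  by (simp_all add: vec_eq_iff matrix_matrix_mult_def scaleR_right.sum)

section \<open>Rank one matrices and Householder reflections\<close>

definition outer :: "complex ^ 'n \<Rightarrow> complex ^ 'm \<Rightarrow> complex ^ 'm ^ 'n" where
  "outer y x = (\<chi> i j. y $ i * cnj (x $ j))"

lemma matrix_mult_outer: "M ** outer y x = outer (M *v y) x"
  by (simp add: vec_eq_iff outer_def matrix_matrix_mult_def matrix_vector_mult_def
      sum_distrib_right mult.assoc)

lemma outer_matrix_mult: "outer y x ** M = outer y (conj_transpose M *v x)"
  by (simp add: vec_eq_iff outer_def matrix_matrix_mult_def matrix_vector_mult_def
      conj_transpose_def sum_distrib_left mult_ac)

lemma outer_matrix_vector: "outer y x *v z = (\<Sum>j\<in>UNIV. cnj (x $ j) * z $ j) *s y"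
  by (simp add: vec_eq_iff outer_def matrix_vector_mult_def sum_distrib_right sum_distrib_left mult_ac)

lemma sum_cnj_self: "(\<Sum>j\<in>UNIV. cnj (x $ j) * x $ j) = complex_of_real ((norm x)\<^sup>2)"
  by (simp add: norm_vec_def L2_set_def sum_nonneg complex_norm_square mult.commute
      del: of_real_power)

lemma outer_vector_self: "outer y x *v x = (norm x)\<^sup>2 *\<^sub>R y"
  by (simp add: outer_matrix_vector sum_cnj_self scalar_mult_eq_scaleR del: of_real_power)

lemma outer_scaleR:
  "outer (r *\<^sub>R y) x = r *\<^sub>R outer y x" "outer y (r *\<^sub>R x) = r *\<^sub>R outer y x"
  by (simp_all add: vec_eq_iff outer_def scaleR_conv_of_real[where 'a=complex])

lemma norm_outer: "norm (outer y x) = norm y * norm x"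
proof -
  have "norm (outer y x $ i) = norm (y $ i) * norm x" for i
    by (simp add: outer_def norm_vec_def norm_mult L2_set_right_distrib)
  then show ?thesis
    by (simp add: norm_vec_def[of "outer y x"] norm_vec_def[of y] L2_set_left_distrib)
qed

lemma conj_transpose_mat_1 [simp]: "conj_transpose (mat 1) = mat 1"
  by (auto simp: vec_eq_iff conj_transpose_def mat_def)

lemma unitary_mat_1: "unitary (mat 1)"
  by (simp add: unitary_def)

lemma unitary_reflection:
  fixes w :: "complex ^ 'n"
  assumes "norm w = 1"
  shows "unitary (mat 1 - 2 *\<^sub>R outer w w)"
proof -
  have "conj_transpose (mat 1 - 2 *\<^sub>R outer w w) = mat 1 - 2 *\<^sub>R outer w w"
    by (auto simp: vec_eq_iff conj_transpose_def mat_def outer_def)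
  moreover have "outer w w ** outer w w = outer w w"
    by (simp add: matrix_mult_outer outer_vector_self assms)
  moreover have "2 *\<^sub>R (P - 2 *\<^sub>R P) = - (2 *\<^sub>R P)" for P :: "complex ^ 'n ^ 'n"
    by (simp add: vec_eq_iff scaleR_conv_of_real[where 'a=complex])
  ultimately show ?thesis
    by (simp add: unitary_def matrix_mult_diff_left matrix_mult_diff_right matrix_mult_scaleR
        matrix_mul_lid matrix_mul_rid)
qed

text \<open>The reflection along \<open>x - y\<close> does it. Equal lengths and a real Hermitian
  product give <x - y, x> = - <x - y, y>, hence <x - y, x> is half of |x - y|^2 and the reflection
  subtracts exactly \<open>x - y\<close> from \<open>x\<close>.\<close>

lemma unitary_map_vector:
  fixes x y :: "complex ^ 'n"
  assumes "norm x = norm y" and real: "(\<Sum>j\<in>UNIV. cnj (y $ j) * x $ j) \<in> \<real>"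
  obtains U where "unitary U" "U *v x = y" "conj_transpose U = U"
proof (cases "x = y")
  case True
  then show ?thesis using that[of "mat 1"] unitary_mat_1 by (simp add: matrix_vector_mul_lid)
next
  case False
  define w where "w = inverse (norm (x - y)) *\<^sub>R (x - y)"
  have w: "norm w = 1" using False by (simp add: w_def)
  define c where "c = (\<Sum>j\<in>UNIV. cnj (y $ j) * x $ j)"
  have cc: "cnj c = c" using real by (simp add: c_def Reals_cnj_iff)
  have c': "(\<Sum>j\<in>UNIV. cnj (x $ j) * y $ j) = c"
    using arg_cong[OF c_def, of cnj] cc by (simp add: mult.commute)
  have s1: "(\<Sum>j\<in>UNIV. cnj ((x - y) $ j) * x $ j) = complex_of_real ((norm x)\<^sup>2) - c"
    unfolding sum_cnj_self[symmetric] c_def by (simp add: left_diff_distrib sum_subtractf)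
  have s2: "(\<Sum>j\<in>UNIV. cnj ((x - y) $ j) * y $ j) = c - complex_of_real ((norm y)\<^sup>2)"
    unfolding sum_cnj_self[symmetric] c'[symmetric] by (simp add: left_diff_distrib sum_subtractf)
  have "(\<Sum>j\<in>UNIV. cnj ((x - y) $ j) * (x - y) $ j) = 2 * (\<Sum>j\<in>UNIV. cnj ((x - y) $ j) * x $ j)"
    using s1 s2 assms(1) by (simp add: right_diff_distrib sum_subtractf)
  then have half: "(\<Sum>j\<in>UNIV. cnj ((x - y) $ j) * x $ j) = complex_of_real ((norm (x - y))\<^sup>2 / 2)"
    unfolding sum_cnj_self by simp
  have "outer w w *v x = (inverse (norm (x - y)))\<^sup>2 *\<^sub>R (outer (x - y) (x - y) *v x)"
    by (simp add: w_def outer_scaleR scaleR_matrix_vector_mult power2_eq_square)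
  also have "\<dots> = (1/2) *\<^sub>R (x - y)"
    using False unfolding outer_matrix_vector half scalar_mult_eq_scaleR
    by (simp add: power2_eq_square field_simps)
  finally have "(mat 1 - 2 *\<^sub>R outer w w) *v x = y"
    by (simp add: matrix_vector_mult_diff_rdistrib scaleR_matrix_vector_mult matrix_vector_mul_lid)
  moreover have "conj_transpose (mat 1 - 2 *\<^sub>R outer w w) = mat 1 - 2 *\<^sub>R outer w w"
    by (auto simp: vec_eq_iff conj_transpose_def mat_def outer_def)
  ultimately show ?thesis using that unitary_reflection[OF w] by blast
qed

lemma
  assumes "unitarily_invariant_norm \<nu>"
  shows uin_nonneg: "0 \<le> \<nu> A"
    and uin_triangle: "\<nu> (A + B) \<le> \<nu> A + \<nu> B"
    and uin_scale: "\<nu> (\<chi> i j. c * A $ i $ j) = cmod c * \<nu> A"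
    and uin_unitary_left: "unitary U \<Longrightarrow> \<nu> (U ** A) = \<nu> A"
    and uin_unitary_right: "unitary U \<Longrightarrow> \<nu> (A ** U) = \<nu> A"
proof -
  have inv: "\<And>A U V. unitary U \<Longrightarrow> unitary V \<Longrightarrow> \<nu> (U ** A ** V) = \<nu> A"
    and "matrix_norm \<nu>"
    using assms by (auto simp: unitarily_invariant_norm_def)
  then show "0 \<le> \<nu> A" "\<nu> (A + B) \<le> \<nu> A + \<nu> B" "\<nu> (\<chi> i j. c * A $ i $ j) = cmod c * \<nu> A"
    by (auto simp: matrix_norm_def)
  show "unitary U \<Longrightarrow> \<nu> (U ** A) = \<nu> A" "unitary U \<Longrightarrow> \<nu> (A ** U) = \<nu> A"
    using inv[of U "mat 1" A] inv[of "mat 1" U A] unitary_mat_1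
    by (auto simp: matrix_mul_lid matrix_mul_rid)
qed

lemma uin_scaleR:
  assumes "unitarily_invariant_norm \<nu>"
  shows "\<nu> (r *\<^sub>R A) = \<bar>r\<bar> * \<nu> A"
proof -
  have "r *\<^sub>R A = (\<chi> i j. complex_of_real r * A $ i $ j)"
    by (simp add: vec_eq_iff scaleR_conv_of_real[where 'a=complex])
  then show ?thesis using uin_scale[OF assms, of "complex_of_real r" A] by simp
qed

text \<open>With the reflection H = I - 2 x x^*, the rank one matrix (M x) x^* is (M - M H) / 2, and
  M H has the same norm as M.\<close>

lemma uin_outer_le:
  assumes \<nu>: "unitarily_invariant_norm \<nu>" and x: "norm x = 1"
  shows "\<nu> (outer (M *v x) x) \<le> \<nu> M"
proof -
  define H where "H = mat 1 - 2 *\<^sub>R outer x x"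
  have H: "\<nu> (M ** H) = \<nu> M"
    unfolding H_def by (rule uin_unitary_right[OF \<nu> unitary_reflection[OF x]])
  have eq: "outer (M *v x) x = (1/2) *\<^sub>R M + (- 1/2) *\<^sub>R (M ** H)"
    by (simp add: H_def matrix_mult_diff_right matrix_mult_scaleR matrix_mult_outer matrix_mul_rid
        scaleR_diff_right)
  show ?thesis
    unfolding eq using uin_triangle[OF \<nu>, of "(1/2) *\<^sub>R M" "(- 1/2) *\<^sub>R (M ** H)"]
    unfolding uin_scaleR[OF \<nu>] H by simp
qed

lemma complex_phase:
  obtains \<alpha> where "cmod \<alpha> = 1" "\<alpha> * c \<in> \<real>"
proof (cases "c = 0")
  case False
  have "cnj c / complex_of_real (cmod c) * c = complex_of_real (cmod c)"
    using False by (simp add: complex_norm_square[symmetric] power2_eq_square mult.commute)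
  then have "cnj c / complex_of_real (cmod c) * c \<in> \<real>" by (metis Reals_of_real)
  then show ?thesis using that[of "cnj c / complex_of_real (cmod c)"] False by (simp add: norm_divide)
qed (auto intro: that[of 1])

text \<open>A unit phase makes the Hermitian product real, and then a reflection carries one vector
  to the other. The norm ignores both operations, so on rank one matrices it sees only the lengths
  of the two factors.\<close>

lemma
  assumes \<nu>: "unitarily_invariant_norm \<nu>" and xy: "norm x = norm y"
  shows uin_outer_left_cong: "\<nu> (outer x z) = \<nu> (outer y z)"
    and uin_outer_right_cong: "\<nu> (outer z x) = \<nu> (outer z y)"
proof -
  obtain \<alpha> where \<alpha>: "cmod \<alpha> = 1" "\<alpha> * (\<Sum>j\<in>UNIV. cnj (y $ j) * x $ j) \<in> \<real>"
    using complex_phase by metis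
  have "norm (\<alpha> *s x) = norm y" using \<alpha> xy by (simp add: norm_vector_scalar_mult)
  moreover have "(\<Sum>j\<in>UNIV. cnj (y $ j) * (\<alpha> *s x) $ j) \<in> \<real>"
    using \<alpha>(2) by (simp add: sum_distrib_left mult_ac)
  ultimately obtain U where U: "unitary U" "U *v (\<alpha> *s x) = y" "conj_transpose U = U"
    by (rule unitary_map_vector)
  have "outer (\<alpha> *s x) z = (\<chi> i j. \<alpha> * outer x z $ i $ j)"
    by (simp add: vec_eq_iff outer_def mult.assoc)
  then have "\<nu> (outer x z) = \<nu> (outer (\<alpha> *s x) z)"
    using uin_scale[OF \<nu>, of \<alpha> "outer x z"] \<alpha>(1) by simp
  also have "\<dots> = \<nu> (U ** outer (\<alpha> *s x) z)"
    by (simp add: uin_unitary_left[OF \<nu> U(1)])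
  also have "\<dots> = \<nu> (outer y z)" by (simp add: matrix_mult_outer U)
  finally show "\<nu> (outer x z) = \<nu> (outer y z)" .
  have "outer z (\<alpha> *s x) = (\<chi> i j. cnj \<alpha> * outer z x $ i $ j)"
    by (simp add: vec_eq_iff outer_def mult_ac)
  then have "\<nu> (outer z x) = \<nu> (outer z (\<alpha> *s x))"
    using uin_scale[OF \<nu>, of "cnj \<alpha>" "outer z x"] \<alpha>(1) by simp
  also have "\<dots> = \<nu> (outer z (\<alpha> *s x) ** U)"
    by (simp add: uin_unitary_right[OF \<nu> U(1)])
  also have "\<dots> = \<nu> (outer z y)" by (simp add: outer_matrix_mult U)
  finally show "\<nu> (outer z x) = \<nu> (outer z y)" .
qed

lemma uin_outer:
  assumes \<nu>: "unitarily_invariant_norm \<nu>"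
  shows "\<nu> (outer y x) = norm y * norm x * c_norm k \<nu>"
proof -
  let ?e = "axis k (1 :: complex)"
  have "\<nu> (outer y x) = \<nu> (outer (norm y *\<^sub>R ?e) (norm x *\<^sub>R ?e))"
    using uin_outer_left_cong[OF \<nu>, of y "norm y *\<^sub>R ?e" x]
      uin_outer_right_cong[OF \<nu>, of x "norm x *\<^sub>R ?e"] by simp
  also have "\<dots> = norm y * norm x * \<nu> (outer ?e ?e)"
    by (simp add: outer_scaleR uin_scaleR[OF \<nu>])
  also have "outer ?e ?e = (\<chi> i j. axis k 1 $ i * axis k 1 $ j)"
    by (simp add: outer_def vec_eq_iff axis_def)
  finally show ?thesis by (simp add: c_norm_def)
qed

text \<open>The bridge from vectors to norms: a lower bound for \<open>M\<close> on a single unit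
  vector bounds every unitarily invariant norm of \<open>M\<close>.\<close>

lemma uin_ge:
  assumes \<nu>: "unitarily_invariant_norm \<nu>" and x: "norm x = 1"
  shows "c_norm k \<nu> * norm (M *v x) \<le> \<nu> M"
  using uin_outer_le[OF assms, of M] uin_outer[OF \<nu>, of "M *v x" x k] x by (simp add: mult.commute)

section \<open>Real matrices acting on complex vectors\<close>

definition re_vec :: "complex ^ 'n \<Rightarrow> real ^ 'n" where "re_vec x = (\<chi> i. Re (x $ i))"
definition im_vec :: "complex ^ 'n \<Rightarrow> real ^ 'n" where "im_vec x = (\<chi> i. Im (x $ i))"
definition cvec :: "real ^ 'n \<Rightarrow> complex ^ 'n" where "cvec v = (\<chi> i. complex_of_real (v $ i))"
definition real_outer :: "real ^ 'n \<Rightarrow> real ^ 'm \<Rightarrow> real ^ 'm ^ 'n" where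
  "real_outer u v = (\<chi> i j. u $ i * v $ j)"

lemma complex_vec_eq_iff: "x = y \<longleftrightarrow> re_vec x = re_vec y \<and> im_vec x = im_vec y"
  by (auto simp: vec_eq_iff re_vec_def im_vec_def complex_eq_iff)

lemma re_im_vec_simps [simp]:
  "re_vec (cmatrix A *v x) = A *v re_vec x"
  "im_vec (cmatrix A *v x) = A *v im_vec x"
  "re_vec (x - y) = re_vec x - re_vec y" "im_vec (x - y) = im_vec x - im_vec y"
  "re_vec (z *s x) = Re z *\<^sub>R re_vec x - Im z *\<^sub>R im_vec x"
  "im_vec (z *s x) = Re z *\<^sub>R im_vec x + Im z *\<^sub>R re_vec x"
  "re_vec 0 = 0" "im_vec 0 = 0" "re_vec (cvec v) = v" "im_vec (cvec v) = 0"
  by (simp_all add: vec_eq_iff re_vec_def im_vec_def cvec_def cmatrix_def matrix_vector_mult_def)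

lemma norm_re_im: "(norm x)\<^sup>2 = (norm (re_vec x))\<^sup>2 + (norm (im_vec x))\<^sup>2"
  by (simp add: norm_vec_def L2_set_def sum_nonneg cmod_power2 sum.distrib re_vec_def im_vec_def)

lemma norm_cvec [simp]: "norm (cvec v) = norm v"
  by (simp add: norm_vec_def cvec_def)

lemma norm_cmatrix: "norm (cmatrix A) = norm A"
  by (simp add: norm_matrix_eq_frobenius cmatrix_def)

lemma cmatrix_diff: "cmatrix (A - B) = cmatrix A - cmatrix B"
  by (simp add: vec_eq_iff cmatrix_def)

lemma cmatrix_real_outer: "cmatrix (real_outer u v) = outer (cvec u) (cvec v)"
  by (simp add: vec_eq_iff cmatrix_def real_outer_def outer_def cvec_def)

lemma real_outer_vector: "real_outer u v *v p = (v \<bullet> p) *\<^sub>R u"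
  by (simp add: vec_eq_iff real_outer_def matrix_vector_mult_def inner_vec_def sum_distrib_left
      sum_distrib_right mult_ac)

lemma cmatrix_vector: "cmatrix A *v cvec v = cvec (A *v v)"
  by (simp add: complex_vec_eq_iff)

lemma conj_transpose_cmatrix: "conj_transpose (cmatrix A) = cmatrix (transpose A)"
  by (simp add: vec_eq_iff conj_transpose_def cmatrix_def transpose_def)

section \<open>Gram matrices, the smallest singular value and its vector\<close>

lemma inner_conj_transpose: "(conj_transpose A *v x) \<bullet> y = x \<bullet> (A *v y)"
proof -
  have inner: "a \<bullet> b = Re (\<Sum>i\<in>UNIV. cnj (a $ i) * b $ i)" for a b :: "complex ^ 'k"
    by (simp add: inner_vec_def inner_complex_def)
  have "(\<Sum>i\<in>UNIV. cnj ((conj_transpose A *v x) $ i) * y $ i)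
      = (\<Sum>i\<in>UNIV. \<Sum>j\<in>UNIV. cnj (x $ j) * (A $ j $ i * y $ i))"
    by (simp add: matrix_vector_mult_def conj_transpose_def sum_distrib_left sum_distrib_right
        mult_ac)
  also have "\<dots> = (\<Sum>j\<in>UNIV. cnj (x $ j) * (A *v y) $ j)"
    by (subst sum.swap) (simp add: matrix_vector_mult_def sum_distrib_left)
  finally show ?thesis unfolding inner by simp
qed

lemma gram_inner: "((conj_transpose A ** A) *v x) \<bullet> y = (A *v x) \<bullet> (A *v y)"
  by (simp add: inner_conj_transpose flip: matrix_vector_mul_assoc)

text \<open>Eigenvectors of the Gram matrix for distinct real eigenvalues are orthogonal, hence
  independent over the reals. Finiteness gives \<open>Min\<close> in \<open>sigma_min\<close> its
  intended meaning.\<close>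

lemma finite_gram_eigenvalues:
  "finite {t. eigenvalue (conj_transpose A ** A) (complex_of_real t)}" (is "finite ?T")
proof -
  have "\<exists>f. \<forall>t\<in>?T. f t \<noteq> 0 \<and> (conj_transpose A ** A) *v f t = t *\<^sub>R f t"
    by (intro bchoice) (auto simp: eigenvalue_def scalar_mult_eq_scaleR)
  then obtain f where f: "\<And>t. t \<in> ?T \<Longrightarrow> f t \<noteq> 0"
    "\<And>t. t \<in> ?T \<Longrightarrow> (conj_transpose A ** A) *v f t = t *\<^sub>R f t" by blast
  have orth: "f s \<bullet> f t = 0" if "s \<in> ?T" "t \<in> ?T" "s \<noteq> t" for s t
  proof -
    have "s * (f s \<bullet> f t) = (A *v f s) \<bullet> (A *v f t)"
      using gram_inner[of A "f s" "f t"] f(2)[OF that(1)] by simp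
    also have "\<dots> = t * (f s \<bullet> f t)"
      using gram_inner[of A "f t" "f s"] f(2)[OF that(2)] by (simp add: inner_commute)
    finally show ?thesis using that(3) by simp
  qed
  have inj: "inj_on f ?T"
    using orth f(1) by (intro inj_onI) (metis inner_eq_zero_iff)
  have "independent (f ` ?T)"
  proof (rule pairwise_orthogonal_independent)
    show "pairwise orthogonal (f ` ?T)"
      unfolding pairwise_def orthogonal_def using orth by blast
    show "0 \<notin> f ` ?T" using f(1) by (metis imageE)
  qed
  then have "finite (f ` ?T)" by (rule independent_imp_finite)
  then show ?thesis using inj by (rule finite_imageD)
qed

lemma exists_minimising_unit_vector:
  fixes X :: "real ^ 'n ^ 'n"
  obtains v where "norm v = 1" "\<And>h. norm (X *v v) * norm h \<le> norm (X *v h)"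
proof -
  have "\<exists>v\<in>sphere 0 1. \<forall>y\<in>sphere 0 1. norm (X *v v) \<le> norm (X *v y)"
    by (intro continuous_attains_inf continuous_intros) auto
  then obtain v where v: "norm v = 1" "\<And>y. norm y = 1 \<Longrightarrow> norm (X *v v) \<le> norm (X *v y)"
    by auto
  have "norm (X *v v) * norm h \<le> norm (X *v h)" for h
  proof (cases "h = 0")
    case False
    then have "norm (X *v v) \<le> norm (X *v (inverse (norm h) *\<^sub>R h))" by (intro v(2)) simp
    then show ?thesis using False by (simp add: matrix_vector_mult_scaleR field_simps)
  qed simp
  then show ?thesis using that v(1) by simp
qed

lemma norm_add_scaleR_squared:
  fixes a b :: "'a::real_inner"
  shows "(norm (a + s *\<^sub>R b))\<^sup>2 = (norm a)\<^sup>2 + 2 * s * (a \<bullet> b) + s\<^sup>2 * (norm b)\<^sup>2"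
  unfolding power2_norm_eq_inner
  by (simp add: inner_add_left inner_add_right inner_commute[of b a] power2_eq_square algebra_simps)

text \<open>First order condition. The nonnegative form |X g|^2 - \<sigma>^2 |g|^2 vanishes at
  \<open>v\<close>, so along v + s h it equals 2 s B + s^2 Q, and this is nonnegative for all s only
  if B = 0.\<close>

lemma minimising_vector_normal_equation:
  fixes X :: "real ^ 'n ^ 'm"
  assumes v: "norm v = 1" and min: "\<And>h. norm (X *v v) * norm h \<le> norm (X *v h)"
  shows "(X *v v) \<bullet> (X *v h) = (norm (X *v v))\<^sup>2 * (v \<bullet> h)"
proof -
  define \<sigma> where "\<sigma> = norm (X *v v)"
  define Q where "Q = (norm (X *v h))\<^sup>2 - \<sigma>\<^sup>2 * (norm h)\<^sup>2"
  define B where "B = (X *v v) \<bullet> (X *v h) - \<sigma>\<^sup>2 * (v \<bullet> h)"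
  have sq: "\<sigma>\<^sup>2 * (norm g)\<^sup>2 \<le> (norm (X *v g))\<^sup>2" for g
    using power_mono[OF min[of g], of 2] by (simp add: \<sigma>_def power_mult_distrib)
  have Q: "Q \<ge> 0" using sq[of h] by (simp add: Q_def)
  have *: "0 \<le> 2 * s * B + s\<^sup>2 * Q" for s
  proof -
    have "(norm (X *v (v + s *\<^sub>R h)))\<^sup>2 = \<sigma>\<^sup>2 + 2 * s * ((X *v v) \<bullet> (X *v h)) + s\<^sup>2 * (norm (X *v h))\<^sup>2"
      by (simp add: \<sigma>_def matrix_vector_right_distrib matrix_vector_mult_scaleR norm_add_scaleR_squared)
    then show ?thesis
      using sq[of "v + s *\<^sub>R h"] v
      by (simp add: Q_def B_def norm_add_scaleR_squared algebra_simps)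
  qed
  have "B = 0"
  proof (rule ccontr)
    assume "B \<noteq> 0"
    \<comment> \<open>The test value s = - B e makes the form e B^2 (e Q - 2). Dividing by
      \<open>Q + 1\<close> keeps \<open>e * Q\<close> below 2 and also covers
      \<open>Q = 0\<close>.\<close>
    define e where "e = 1 / (Q + 1)"
    have e: "e > 0" "e * Q \<le> 1" using Q by (auto simp: e_def field_simps)
    have "2 * (- B * e) * B + (- B * e)\<^sup>2 * Q = (e * B\<^sup>2) * (e * Q - 2)"
      by (simp add: power2_eq_square algebra_simps)
    also have "\<dots> < 0" using e \<open>B \<noteq> 0\<close> by (intro mult_pos_neg) auto
    finally show False using *[of "- B * e"] by linarith
  qed
  then show ?thesis by (simp add: B_def \<sigma>_def)
qed

text \<open>The minimum over real vectors is also the one over complex vectors, because a real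
  matrix acts separately on real and imaginary parts. It is attained: by the normal equation
  \<open>v\<close> is an eigenvector of the Gram matrix for \<sigma>^2.\<close>

lemma sigma_min_cmatrix:
  fixes X :: "real ^ 'n ^ 'n"
  assumes v: "norm v = 1" and min: "\<And>h. norm (X *v v) * norm h \<le> norm (X *v h)"
  shows "sigma_min (cmatrix X) = norm (X *v v)"
proof -
  define \<sigma> where "\<sigma> = norm (X *v v)"
  let ?G = "conj_transpose (cmatrix X) ** cmatrix X"
  show ?thesis
    unfolding sigma_min_def singular_values_def \<sigma>_def[symmetric]
  proof (rule Min_eqI)
    show "finite (sqrt ` {t. eigenvalue ?G (complex_of_real t)})"
      by (intro finite_imageI finite_gram_eigenvalues)
    show "\<sigma> \<le> s" if s: "s \<in> sqrt ` {t. eigenvalue ?G (complex_of_real t)}" for s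
    proof -
      obtain t where t: "s = sqrt t" and ev: "eigenvalue ?G (complex_of_real t)"
        using s by blast
      obtain x where x: "x \<noteq> 0" "?G *v x = t *\<^sub>R x"
        using ev unfolding eigenvalue_def scalar_mult_eq_scaleR by blast
      have "\<sigma>\<^sup>2 * (norm x)\<^sup>2 = (\<sigma> * norm (re_vec x))\<^sup>2 + (\<sigma> * norm (im_vec x))\<^sup>2"
        by (simp add: norm_re_im[of x] algebra_simps power_mult_distrib)
      also have "\<dots> \<le> (norm (X *v re_vec x))\<^sup>2 + (norm (X *v im_vec x))\<^sup>2"
        unfolding \<sigma>_def by (intro add_mono power_mono min) auto
      also have "\<dots> = (norm (cmatrix X *v x))\<^sup>2"
        by (simp add: norm_re_im[of "cmatrix X *v x"])
      also have "\<dots> = t * (norm x)\<^sup>2"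
        using gram_inner[of "cmatrix X" x x] x(2) by (simp add: power2_norm_eq_inner)
      finally have "\<sigma>\<^sup>2 \<le> t" using x(1) by simp
      then show ?thesis unfolding t by (rule real_le_rsqrt)
    qed
    have "(transpose X *v (X *v v)) \<bullet> h = (\<sigma>\<^sup>2 *\<^sub>R v) \<bullet> h" for h
      using minimising_vector_normal_equation[OF v min, of h]
      by (simp add: transpose_matrix_vector dot_lmul_matrix \<sigma>_def)
    then have "transpose X *v (X *v v) = \<sigma>\<^sup>2 *\<^sub>R v"
      using vector_eq_rdot by blast
    then have "?G *v cvec v = complex_of_real (\<sigma>\<^sup>2) *s cvec v"
      by (simp add: complex_vec_eq_iff conj_transpose_cmatrix flip: matrix_vector_mul_assoc)
    moreover have "cvec v \<noteq> 0" using v by (metis norm_cvec norm_zero zero_neq_one)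
    ultimately have "eigenvalue ?G (complex_of_real (\<sigma>\<^sup>2))" unfolding eigenvalue_def by blast
    then show "\<sigma> \<in> sqrt ` {t. eigenvalue ?G (complex_of_real t)}"
      by (intro image_eqI[of _ _ "\<sigma>\<^sup>2"]) (auto simp: \<sigma>_def)
  qed
qed

lemma inner_outer: "N \<bullet> outer y x = (N *v x) \<bullet> y"
proof -
  have "a \<bullet> (b * cnj c) = (a * c) \<bullet> b" for a b c :: complex
    by (simp add: inner_complex_def algebra_simps)
  then have "N $ i \<bullet> outer y x $ i = (\<Sum>j\<in>UNIV. N $ i $ j * x $ j) \<bullet> y $ i" for i
    by (simp add: inner_vec_def outer_def inner_sum_left)
  then show ?thesis
    unfolding inner_vec_def[of N] inner_vec_def[of "N *v x"] by (simp add: matrix_vector_mult_def)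
qed

text \<open>Pythagoras: M - (M x) x^* annihilates \<open>x\<close> and is therefore orthogonal to (M
  x) x^* in the Frobenius inner product.\<close>

lemma norm_diff_outer:
  assumes "norm x = 1"
  shows "(norm M)\<^sup>2 = (norm (M - outer (M *v x) x))\<^sup>2 + (norm (M *v x))\<^sup>2"
proof -
  define N where "N = M - outer (M *v x) x"
  have "N *v x = 0"
    by (simp add: N_def matrix_vector_mult_diff_rdistrib outer_vector_self assms)
  then have "N \<bullet> outer (M *v x) x = 0" by (simp add: inner_outer)
  then have "(norm (N + 1 *\<^sub>R outer (M *v x) x))\<^sup>2 = (norm N)\<^sup>2 + (norm (outer (M *v x) x))\<^sup>2"
    unfolding norm_add_scaleR_squared by simp
  then show ?thesis by (simp add: N_def norm_outer assms)
qed

section \<open>Perturbations of the diagonal matrix\<close>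

lemma D_matrix_vector: "(D_matrix k *v x) $ i = (if i = k then x $ k else - 2 * x $ i)"
proof -
  have "(if i = j then c else 0) * x $ j = (if j = i then c * x $ i else 0)" for c j
    by simp
  then show ?thesis by (simp add: D_matrix_def matrix_vector_mult_def)
qed

lemma norm_D_matrix_vector: "(norm (D_matrix k *v x))\<^sup>2 = 4 * (norm x)\<^sup>2 - 3 * (x $ k)\<^sup>2"
proof -
  have "(norm (D_matrix k *v x))\<^sup>2 = (\<Sum>i\<in>UNIV. 4 * (x $ i)\<^sup>2 - (if i = k then 3 * (x $ k)\<^sup>2 else 0))"
    unfolding norm_vec_def L2_set_def
    by (auto simp: sum_nonneg D_matrix_vector intro!: sum.cong)
  also have "\<dots> = 4 * (norm x)\<^sup>2 - 3 * (x $ k)\<^sup>2"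
    by (simp add: sum_subtractf norm_vec_def L2_set_def sum_nonneg sum_distrib_left)
  finally show ?thesis .
qed

lemma inner_D_matrix_vector: "x \<bullet> (D_matrix k *v x) = 3 * (x $ k)\<^sup>2 - 2 * (norm x)\<^sup>2"
proof -
  have "x \<bullet> (D_matrix k *v x) = (\<Sum>i\<in>UNIV. (if i = k then 3 * (x $ k)\<^sup>2 else 0) - 2 * (x $ i)\<^sup>2)"
    unfolding inner_vec_def
    by (auto simp: D_matrix_vector power2_eq_square intro!: sum.cong)
  also have "\<dots> = 3 * (x $ k)\<^sup>2 - 2 * (norm x)\<^sup>2"
    by (simp add: sum_subtractf norm_vec_def L2_set_def sum_nonneg sum_distrib_left)
  finally show ?thesis .
qed

lemma D_matrix_selfadjoint: "x \<bullet> (D_matrix k *v y) = y \<bullet> (D_matrix k *v x)"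
  by (auto simp: inner_vec_def D_matrix_vector intro!: sum.cong)

lemma component_squared_le: "(x $ k)\<^sup>2 \<le> (norm x)\<^sup>2" for x :: "real ^ 'n"
  using component_le_norm_cart[of x k] power_mono[of "\<bar>x $ k\<bar>" "norm x" 2] by simp

lemma norm_D_matrix_vector_ge: "norm x \<le> norm (D_matrix k *v x)"
  by (rule power2_le_imp_le) (use component_squared_le[of x k] in \<open>auto simp: norm_D_matrix_vector\<close>)

lemma not_hurwitz_stable_D_matrix:
  fixes k :: "'n::finite"
  shows "\<not> hurwitz_stable (cmatrix (D_matrix k))"
proof -
  have "D_matrix k *v axis k 1 = axis k 1"
    by (simp add: vec_eq_iff D_matrix_vector axis_def)
  then have "cmatrix (D_matrix k) *v cvec (axis k 1) = 1 *s cvec (axis k 1)"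
    by (simp add: cmatrix_vector)
  moreover have "cvec (axis k 1 :: real ^ 'n) \<noteq> 0"
    by (metis norm_cvec norm_axis_1 norm_zero zero_neq_one)
  ultimately have "eigenvalue (cmatrix (D_matrix k)) 1"
    unfolding eigenvalue_def by blast
  then show ?thesis by (force simp: hurwitz_stable_def)
qed

text \<open>Otherwise some matrix on the segment from \<open>D_matrix k\<close> to \<open>X\<close>
  would have an eigenvalue i \<omega>. But D is symmetric, so |(D - i \<omega>) x| \<ge> |D x| \<ge>
  1 for a unit vector, while the perturbation moves \<open>x\<close> by less than 1/4.\<close>

lemma not_hurwitz_stable_U_ball:
  assumes X: "X \<in> U_ball k"
  shows "\<not> hurwitz_stable (cmatrix X)"
proof
  assume "hurwitz_stable (cmatrix X)"
  then obtain t \<omega> x where t: "0 < t" "t \<le> 1" and x: "norm x = 1"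
    and eq: "(cmatrix (D_matrix k) + t *\<^sub>R (cmatrix X - cmatrix (D_matrix k))) *v x = (\<i> * complex_of_real \<omega>) *s x"
    using unstable_stable_segment[OF not_hurwitz_stable_D_matrix] by metis
  define E where "E = cmatrix (X - D_matrix k)"
  define p where "p = re_vec x"
  define q where "q = im_vec x"
  have "norm E < 1/4" using X by (simp add: E_def norm_cmatrix U_ball_def)
  then have "norm (E *v x) < 1/4"
    using norm_matrix_vector_mult_le[of E x] x by simp
  moreover have "norm (t *\<^sub>R (E *v x)) \<le> norm (E *v x)"
    using t by (simp add: mult_left_le_one_le)
  ultimately have small: "norm (t *\<^sub>R (E *v x)) < 1/4" by linarith
  have D: "cmatrix (D_matrix k) *v x - (\<i> * complex_of_real \<omega>) *s x = - (t *\<^sub>R (E *v x))"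
    using eq by (simp add: E_def cmatrix_diff matrix_vector_mult_add_rdistrib scaleR_matrix_vector_mult
        matrix_vector_mult_diff_rdistrib scaleR_diff_right algebra_simps)
  have "1 = (norm p)\<^sup>2 + (norm q)\<^sup>2"
    using norm_re_im[of x] x by (simp add: p_def q_def)
  also have "\<dots> \<le> (norm (D_matrix k *v p))\<^sup>2 + (norm (D_matrix k *v q))\<^sup>2"
    by (intro add_mono power_mono norm_D_matrix_vector_ge) auto
  \<comment> \<open>The two cross terms cancel by symmetry of D; what is added is \<omega>^2 times
    the squared lengths.\<close>
  also have "\<dots> \<le> (norm (D_matrix k *v p + \<omega> *\<^sub>R q))\<^sup>2 + (norm (D_matrix k *v q + (- \<omega>) *\<^sub>R p))\<^sup>2"
    unfolding norm_add_scaleR_squared using D_matrix_selfadjoint[of p k q]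
      inner_commute[of p "D_matrix k *v q"] inner_commute[of q "D_matrix k *v p"] by simp
  also have "\<dots> = (norm (cmatrix (D_matrix k) *v x - (\<i> * complex_of_real \<omega>) *s x))\<^sup>2"
    unfolding norm_re_im[of "_ - _"] by (simp add: p_def q_def)
  also have "\<dots> < (1/4)\<^sup>2"
    unfolding D norm_minus_cancel using small by (intro power_strict_mono) auto
  finally show False by (simp add: power2_eq_square)
qed

section \<open>A matrix of the ball together with a minimising vector\<close>

locale minimal_vector_near_D =
  fixes k :: "'n::finite" and X :: "real ^ 'n ^ 'n" and v :: "real ^ 'n"
  assumes X: "X \<in> U_ball k" and v: "norm v = 1"
    and min: "\<And>h. norm (X *v v) * norm h \<le> norm (X *v h)"
begin

definition \<sigma> where "\<sigma> = norm (X *v v)"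

lemma norm_perturbation: "norm ((X - D_matrix k) *v h) \<le> norm h / 4"
proof -
  have "norm ((X - D_matrix k) *v h) \<le> norm (X - D_matrix k) * norm h"
    by (rule norm_matrix_vector_mult_le)
  also have "\<dots> \<le> 1/4 * norm h" using X by (intro mult_right_mono) (auto simp: U_ball_def)
  finally show ?thesis by simp
qed

lemma
  shows norm_X_le: "norm (X *v h) \<le> norm (D_matrix k *v h) + norm h / 4"
    and norm_X_ge: "norm (D_matrix k *v h) - norm h / 4 \<le> norm (X *v h)"
proof -
  have eq: "X *v h = D_matrix k *v h + (X - D_matrix k) *v h"
    by (simp add: matrix_vector_mult_diff_rdistrib)
  show "norm (X *v h) \<le> norm (D_matrix k *v h) + norm h / 4"
    unfolding eq using norm_perturbation[of h] by (intro norm_triangle_le) simp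
  show "norm (D_matrix k *v h) - norm h / 4 \<le> norm (X *v h)"
    using norm_perturbation[of h] norm_diff_ineq[of "D_matrix k *v h" "(X - D_matrix k) *v h"]
    unfolding eq[symmetric] by linarith
qed

lemma \<sigma>_le: "\<sigma> \<le> 5/4"
proof -
  have "D_matrix k *v axis k 1 = axis k 1"
    by (simp add: vec_eq_iff D_matrix_vector axis_def)
  then show ?thesis using min[of "axis k 1"] norm_X_le[of "axis k 1"] by (simp add: \<sigma>_def)
qed

lemma \<sigma>_ge: "3/4 \<le> \<sigma>"
  using norm_X_ge[of v] norm_D_matrix_vector_ge[of v k] v by (simp add: \<sigma>_def)

text \<open>|D v| \<le> \<sigma> + 1/4 \<le> 3/2 and |D v|^2 = 4 - 3 v_k^2, so v_k^2 is at least (4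
  - 9/4) / 3.\<close>

lemma v_component: "7/12 \<le> (v $ k)\<^sup>2"
proof -
  have "norm (D_matrix k *v v) \<le> 3/2"
    using norm_X_ge[of v] v \<sigma>_le by (simp add: \<sigma>_def)
  then have "(norm (D_matrix k *v v))\<^sup>2 \<le> (3/2)\<^sup>2" by (intro power_mono) auto
  then show ?thesis unfolding norm_D_matrix_vector using v by (simp add: power_divide)
qed

text \<open>On the orthogonal complement of \<open>v\<close> the coordinate \<open>r $ k\<close> is
  the product with the part \<open>e\<close> of the basis vector orthogonal to \<open>v\<close>,
  whose squared length is 1 - v_k^2 \<le> 5/12.\<close>

lemma orthogonal_component:
  assumes "v \<bullet> r = 0"
  shows "(r $ k)\<^sup>2 \<le> 5/12 * (norm r)\<^sup>2"
proof -
  define e where "e = axis k 1 + (- (v $ k)) *\<^sub>R v"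
  have "(norm e)\<^sup>2 = 1 - (v $ k)\<^sup>2"
    unfolding e_def norm_add_scaleR_squared using v
    by (simp add: inner_axis' power2_eq_square)
  then have e: "(norm e)\<^sup>2 \<le> 5/12" using v_component by simp
  have "r $ k = e \<bullet> r"
    using assms by (simp add: e_def inner_diff_left inner_axis')
  then have "\<bar>r $ k\<bar> \<le> norm e * norm r" using Cauchy_Schwarz_ineq2[of e r] by simp
  then have "(r $ k)\<^sup>2 \<le> (norm e)\<^sup>2 * (norm r)\<^sup>2"
    using power_mono[of "\<bar>r $ k\<bar>" "norm e * norm r" 2] by (simp add: power_mult_distrib)
  also have "\<dots> \<le> 5/12 * (norm r)\<^sup>2" using e by (intro mult_right_mono) auto
  finally show ?thesis .
qed

text \<open>For a unit vector r, |D r|^2 \<ge> 4 - 5/4 = 11/4 > (33/20)^2, so |X r| \<ge> 33/20 -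
  1/4 = 7/5; and (7/5)^2 = 1.96 exceeds (5/4)^2 + 3/8 = 1.9375.\<close>

lemma norm_X_orthogonal:
  assumes "v \<bullet> r = 0"
  shows "(\<sigma>\<^sup>2 + 3/8) * (norm r)\<^sup>2 \<le> (norm (X *v r))\<^sup>2"
proof -
  have "(33/20 * norm r)\<^sup>2 = 1089/400 * (norm r)\<^sup>2"
    by (simp add: power_mult_distrib power_divide)
  then have "(33/20 * norm r)\<^sup>2 \<le> (norm (D_matrix k *v r))\<^sup>2"
    unfolding norm_D_matrix_vector
    using orthogonal_component[OF assms] zero_le_power2[of "norm r"] by linarith
  then have "33/20 * norm r \<le> norm (D_matrix k *v r)" by (rule power2_le_imp_le) simp
  then have "7/5 * norm r \<le> norm (X *v r)" using norm_X_ge[of r] by simp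
  then have "(7/5 * norm r)\<^sup>2 \<le> (norm (X *v r))\<^sup>2" by (intro power_mono) auto
  moreover have "\<sigma>\<^sup>2 \<le> (5/4)\<^sup>2" using \<sigma>_le \<sigma>_ge by (intro power_mono) auto
  then have "(\<sigma>\<^sup>2 + 3/8) * (norm r)\<^sup>2 \<le> (7/5)\<^sup>2 * (norm r)\<^sup>2"
    by (intro mult_right_mono) (auto simp: power2_eq_square)
  ultimately show ?thesis unfolding power_mult_distrib by linarith
qed

text \<open>The diagonal part contributes at most 3 * 5/12 - 2 = -3/4 and the perturbation at most
  1/4.\<close>

lemma inner_X_orthogonal:
  assumes "v \<bullet> r = 0"
  shows "r \<bullet> (X *v r) \<le> - (1/2) * (norm r)\<^sup>2"
proof -
  have "r \<bullet> ((X - D_matrix k) *v r) \<le> norm r * (norm r / 4)"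
    using norm_perturbation[of r] by (meson mult_left_mono norm_cauchy_schwarz norm_ge_zero order_trans)
  then show ?thesis
    using inner_D_matrix_vector[of r k] orthogonal_component[OF assms]
    by (simp add: matrix_vector_mult_diff_rdistrib inner_diff_right power2_eq_square)
qed

section \<open>Lower bound for the shifts X - i \<omega>\<close>

definition skew :: "real ^ 'n \<Rightarrow> real ^ 'n \<Rightarrow> real" where
  "skew q p = q \<bullet> (X *v p) - p \<bullet> (X *v q)"

text \<open>The symmetric matrix \<open>D_matrix k\<close> cancels, and each of the two remaining
  terms of the perturbation costs a quarter.\<close>

lemma skew_bound: "\<bar>skew q p\<bar> \<le> norm q * norm p / 2"
proof -
  let ?E = "X - D_matrix k"
  have "\<bar>a \<bullet> (?E *v b)\<bar> \<le> norm a * norm b / 4" for a b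
  proof -
    have "\<bar>a \<bullet> (?E *v b)\<bar> \<le> norm a * norm (?E *v b)" by (rule Cauchy_Schwarz_ineq2)
    also have "\<dots> \<le> norm a * (norm b / 4)" by (intro mult_left_mono norm_perturbation) auto
    finally show ?thesis by simp
  qed
  from this[of q p] this[of p q]
  have "\<bar>q \<bullet> (?E *v p) - p \<bullet> (?E *v q)\<bar> \<le> norm q * norm p / 4 + norm p * norm q / 4"
    by linarith
  moreover have "skew q p = q \<bullet> (?E *v p) - p \<bullet> (?E *v q)"
    using D_matrix_selfadjoint[of p k q]
    by (simp add: skew_def matrix_vector_mult_diff_rdistrib inner_diff_right)
  ultimately show ?thesis by (simp add: mult.commute)
qed

text \<open>By the normal equation X maps \<open>v\<close> and its orthogonal complement to
  orthogonal directions, so the squared norms add without a cross term.\<close>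

lemma norm_X_decompose:
  fixes p
  defines "r \<equiv> p - (v \<bullet> p) *\<^sub>R v"
  shows "\<sigma>\<^sup>2 * (norm p)\<^sup>2 + 3/8 * (norm r)\<^sup>2 \<le> (norm (X *v p))\<^sup>2"
    and "(norm p)\<^sup>2 = (v \<bullet> p)\<^sup>2 + (norm r)\<^sup>2"
    and "v \<bullet> r = 0"
proof -
  have vv: "v \<bullet> v = 1" using v by (simp add: dot_square_norm)
  show o: "v \<bullet> r = 0" by (simp add: r_def inner_diff_right vv)
  have p: "p = r + (v \<bullet> p) *\<^sub>R v" by (simp add: r_def)
  show n: "(norm p)\<^sup>2 = (v \<bullet> p)\<^sup>2 + (norm r)\<^sup>2"
    using norm_add_scaleR_squared[of r "v \<bullet> p" v] o v by (simp add: r_def inner_commute)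
  have "X *v p = X *v r + (v \<bullet> p) *\<^sub>R (X *v v)"
    by (subst p) (simp only: matrix_vector_right_distrib matrix_vector_mult_scaleR)
  moreover have "(X *v r) \<bullet> (X *v v) = 0"
    using minimising_vector_normal_equation[OF v min, of r] o by (simp add: inner_commute)
  ultimately have "(norm (X *v p))\<^sup>2 = (norm (X *v r))\<^sup>2 + (v \<bullet> p)\<^sup>2 * \<sigma>\<^sup>2"
    by (simp add: norm_add_scaleR_squared \<sigma>_def)
  then show "\<sigma>\<^sup>2 * (norm p)\<^sup>2 + 3/8 * (norm r)\<^sup>2 \<le> (norm (X *v p))\<^sup>2"
    using norm_X_orthogonal[OF o] n by (simp add: algebra_simps)
qed

text \<open>With x = p + i q, the squared norm is |X p|^2 + |X q|^2 + \<omega>^2 |x|^2 + 2 \<omega>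
  \<open>skew q p\<close>. The last term is estimated by the parts \<open>r\<close>,
  \<open>s\<close> orthogonal to \<open>v\<close>, for which the gap 3/8 is available. The two
  surplus terms on the left decide the equality case.\<close>

lemma resolvent_gap:
  fixes x :: "complex ^ 'n"
  defines "a \<equiv> v \<bullet> re_vec x" and "b \<equiv> v \<bullet> im_vec x"
  defines "r \<equiv> re_vec x - a *\<^sub>R v" and "s \<equiv> im_vec x - b *\<^sub>R v"
  shows "\<sigma>\<^sup>2 * (norm x)\<^sup>2 + ((norm r)\<^sup>2 + (norm s)\<^sup>2) / 32 + \<omega>\<^sup>2 * (a\<^sup>2 + b\<^sup>2) / 10
    \<le> (norm (cmatrix X *v x - (\<i> * complex_of_real \<omega>) *s x))\<^sup>2"
proof -
  define p where "p = re_vec x"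
  define q where "q = im_vec x"
  define R where "R = norm r"
  define S where "S = norm s"
  define w where "w = \<bar>\<omega>\<bar>"
  have p: "p = r + a *\<^sub>R v" and q: "q = s + b *\<^sub>R v" by (simp_all add: p_def q_def r_def s_def)
  have P: "\<sigma>\<^sup>2 * (norm p)\<^sup>2 + 3/8 * R\<^sup>2 \<le> (norm (X *v p))\<^sup>2" "(norm p)\<^sup>2 = a\<^sup>2 + R\<^sup>2"
    using norm_X_decompose(1,2)[of p] by (auto simp: p_def r_def a_def R_def)
  have Q: "\<sigma>\<^sup>2 * (norm q)\<^sup>2 + 3/8 * S\<^sup>2 \<le> (norm (X *v q))\<^sup>2" "(norm q)\<^sup>2 = b\<^sup>2 + S\<^sup>2"
    using norm_X_decompose(1,2)[of q] by (auto simp: q_def s_def b_def S_def)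
  have n: "(norm x)\<^sup>2 = (norm p)\<^sup>2 + (norm q)\<^sup>2" by (simp add: norm_re_im p_def q_def)
  have "(norm (cmatrix X *v x - (\<i> * complex_of_real \<omega>) *s x))\<^sup>2
      = (norm (X *v p + \<omega> *\<^sub>R q))\<^sup>2 + (norm (X *v q + (- \<omega>) *\<^sub>R p))\<^sup>2"
    unfolding norm_re_im[of "_ - _"] by (simp add: p_def q_def)
  also have "\<dots> = (norm (X *v p))\<^sup>2 + (norm (X *v q))\<^sup>2 + \<omega>\<^sup>2 * ((norm p)\<^sup>2 + (norm q)\<^sup>2) + 2 * \<omega> * skew q p"
    unfolding norm_add_scaleR_squared by (simp add: skew_def inner_commute algebra_simps)
  finally have L: "(norm (cmatrix X *v x - (\<i> * complex_of_real \<omega>) *s x))\<^sup>2 = \<dots>" .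
  \<comment> \<open>The form is bilinear and alternating, so the contribution of \<open>v\<close>
    with itself drops out and every term contains \<open>r\<close> or \<open>s\<close>.\<close>
  have "skew q p = b * skew v r + a * skew s v + skew s r"
    by (simp add: p q skew_def matrix_vector_right_distrib matrix_vector_mult_scaleR
        inner_add_left inner_add_right algebra_simps)
  then have "\<bar>skew q p\<bar> \<le> \<bar>b\<bar> * \<bar>skew v r\<bar> + \<bar>a\<bar> * \<bar>skew s v\<bar> + \<bar>skew s r\<bar>"
    by (simp add: abs_mult[symmetric])
  also have "\<dots> \<le> \<bar>b\<bar> * (R / 2) + \<bar>a\<bar> * (S / 2) + S * R / 2"
    using skew_bound[of v r] skew_bound[of s v] skew_bound[of s r] v
    by (intro add_mono mult_left_mono) (auto simp: R_def S_def)
  finally have "2 * w * \<bar>skew q p\<bar> \<le> 2 * w * (\<bar>b\<bar> * (R / 2) + \<bar>a\<bar> * (S / 2) + S * R / 2)"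
    by (intro mult_left_mono) (auto simp: w_def)
  moreover have "- (2 * \<omega> * skew q p) \<le> 2 * w * \<bar>skew q p\<bar>"
    using abs_ge_minus_self[of "2 * \<omega> * skew q p"] by (simp add: w_def abs_mult)
  ultimately have "- (2 * \<omega> * skew q p) \<le> 2 * w * (\<bar>b\<bar> * (R / 2) + \<bar>a\<bar> * (S / 2) + S * R / 2)"
    by (rule order_trans[rotated])
  also have "\<dots> = (w * \<bar>b\<bar>) * R + (w * \<bar>a\<bar>) * S + w * (R * S)"
    by (simp add: distrib_left mult_ac)
  finally have K: "- (2 * \<omega> * skew q p) \<le> (w * \<bar>b\<bar>) * R + (w * \<bar>a\<bar>) * S + w * (R * S)" .
  \<comment> \<open>weights chosen so that \<open>9/10 < 1\<close> and \<open>5/18 + 1/16 < 3/8\<close>, which leaves a positive gap\<close>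
  have amgm: "y * z \<le> 9/10 * y\<^sup>2 + 5/18 * z\<^sup>2" for y z :: real
    using zero_le_power2[of "9 * y - 5 * z"] by (simp add: power2_eq_square algebra_simps)
  have 1: "(w * \<bar>b\<bar>) * R \<le> 9/10 * (\<omega>\<^sup>2 * b\<^sup>2) + 5/18 * R\<^sup>2"
    using amgm[of "w * \<bar>b\<bar>" R] by (simp add: power_mult_distrib w_def)
  have 2: "(w * \<bar>a\<bar>) * S \<le> 9/10 * (\<omega>\<^sup>2 * a\<^sup>2) + 5/18 * S\<^sup>2"
    using amgm[of "w * \<bar>a\<bar>" S] by (simp add: power_mult_distrib w_def)
  have "w * (R * S) \<le> w * ((R\<^sup>2 + S\<^sup>2) / 2)"
    using sum_squares_bound[of R S] by (intro mult_left_mono) (auto simp: w_def)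
  also have "\<dots> = w / 2 * (R\<^sup>2 + S\<^sup>2)" by simp
  also have "\<dots> \<le> (\<omega>\<^sup>2 + 1/16) * (R\<^sup>2 + S\<^sup>2)"
  proof (rule mult_right_mono)
    show "w / 2 \<le> \<omega>\<^sup>2 + 1/16"
      using zero_le_power2[of "w - 1/4"] by (simp add: w_def power2_eq_square algebra_simps)
  qed simp
  finally have 3: "w * (R * S) \<le> \<omega>\<^sup>2 * (R\<^sup>2 + S\<^sup>2) + 1/16 * (R\<^sup>2 + S\<^sup>2)" by (simp add: algebra_simps)
  \<comment> \<open>Pure linear arithmetic in the squares. The remainders are 1 - 9/10 = 1/10 and
    3/8 - 5/18 - 1/16 = 5/144, which is more than 1/32.\<close>
  have combine: "c + (R2 + S2) / 32 + (A + B) / 10 \<le> L"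
    if "c = cp + cq" "W = A + B + T" "L = xp + xq + W + K" "cp + 3/8 * R2 \<le> xp" "cq + 3/8 * S2 \<le> xq"
      "- K \<le> y1 + y2 + y3" "y1 \<le> 9/10 * B + 5/18 * R2" "y2 \<le> 9/10 * A + 5/18 * S2"
      "y3 \<le> T + 1/16 * (R2 + S2)" "0 \<le> R2" "0 \<le> S2"
    for A B K L R2 S2 T W c cp cq xp xq y1 y2 y3 :: real
    using that by (simp add: field_simps)
  have "\<sigma>\<^sup>2 * (norm x)\<^sup>2 = \<sigma>\<^sup>2 * (norm p)\<^sup>2 + \<sigma>\<^sup>2 * (norm q)\<^sup>2" by (simp add: n algebra_simps)
  moreover have "\<omega>\<^sup>2 * ((norm p)\<^sup>2 + (norm q)\<^sup>2) = \<omega>\<^sup>2 * a\<^sup>2 + \<omega>\<^sup>2 * b\<^sup>2 + \<omega>\<^sup>2 * (R\<^sup>2 + S\<^sup>2)"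
    by (simp add: P Q algebra_simps)
  ultimately have "\<sigma>\<^sup>2 * (norm x)\<^sup>2 + (R\<^sup>2 + S\<^sup>2) / 32 + (\<omega>\<^sup>2 * a\<^sup>2 + \<omega>\<^sup>2 * b\<^sup>2) / 10
      \<le> (norm (cmatrix X *v x - (\<i> * complex_of_real \<omega>) *s x))\<^sup>2"
    by (rule combine[OF _ _ L P(1) Q(1) K 1 2 3]) auto
  then show ?thesis by (simp add: R_def S_def distrib_left)
qed

text \<open>The vector \<open>x\<close> is the eigenvector met on the segment from X to
  \<open>Y\<close>, where t (X - Y) x = (X - i \<omega>) x. If the residual is no longer than
  \<sigma>, the surplus of \<open>resolvent_gap\<close> must vanish, which puts \<open>x\<close> on
  the complex line of \<open>v\<close> with \<omega> = 0.\<close>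

lemma norm_residual_ge:
  assumes Y: "hurwitz_stable Y"
  obtains x where "norm x = 1" "\<sigma> \<le> norm ((cmatrix X - Y) *v x)"
    "norm ((cmatrix X - Y) *v x) \<le> \<sigma> \<Longrightarrow> Y *v cvec v = 0"
proof -
  obtain t \<omega> x where t: "0 < t" "t \<le> 1" and x: "norm x = 1"
    and eq: "(cmatrix X + t *\<^sub>R (Y - cmatrix X)) *v x = (\<i> * complex_of_real \<omega>) *s x"
    using unstable_stable_segment[OF not_hurwitz_stable_U_ball[OF X] Y] by metis
  define a where "a = v \<bullet> re_vec x"
  define b where "b = v \<bullet> im_vec x"
  define r where "r = re_vec x - a *\<^sub>R v"
  define s where "s = im_vec x - b *\<^sub>R v"
  define N where "N = norm ((cmatrix X - Y) *v x)"
  have "t *\<^sub>R ((cmatrix X - Y) *v x) = cmatrix X *v x - (\<i> * complex_of_real \<omega>) *s x"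
    unfolding eq[symmetric]
    by (simp add: matrix_vector_mult_add_rdistrib scaleR_matrix_vector_mult
        matrix_vector_mult_diff_rdistrib scaleR_diff_right)
  then have tN: "norm (cmatrix X *v x - (\<i> * complex_of_real \<omega>) *s x) = t * N"
    using t by (metis N_def abs_of_pos norm_scaleR)
  have gap: "\<sigma>\<^sup>2 + ((norm r)\<^sup>2 + (norm s)\<^sup>2) / 32 + \<omega>\<^sup>2 * (a\<^sup>2 + b\<^sup>2) / 10 \<le> (t * N)\<^sup>2"
    using resolvent_gap[of x \<omega>] x tN by (simp add: a_def b_def r_def s_def)
  have "\<sigma>\<^sup>2 \<le> (t * N)\<^sup>2"
    by (rule order_trans[OF _ gap]) simp
  then have tNge: "\<sigma> \<le> t * N" by (rule power2_le_imp_le) (use t in \<open>auto simp: N_def\<close>)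
  have tNle: "t * N \<le> N" using t by (simp add: N_def mult_left_le_one_le)
  show ?thesis
  proof (rule that[OF x])
    show "\<sigma> \<le> norm ((cmatrix X - Y) *v x)" using tNge tNle by (simp add: N_def)
    assume "norm ((cmatrix X - Y) *v x) \<le> \<sigma>"
    then have "N \<le> \<sigma>" by (simp add: N_def)
    then have N: "N = \<sigma>" and "t * N = N" using tNge tNle by linarith+
    \<comment> \<open>\<open>t * N = N\<close> can be cancelled because N = \<sigma> \<ge> 3/4; the
      crossing thus happens at \<open>Y\<close> itself.\<close>
    then have "t = 1" using \<sigma>_ge by auto
    have "((norm r)\<^sup>2 + (norm s)\<^sup>2) / 32 + \<omega>\<^sup>2 * (a\<^sup>2 + b\<^sup>2) / 10 \<le> 0"
      using gap unfolding \<open>t = 1\<close> N mult_1_left by linarith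
    moreover have "0 \<le> \<omega>\<^sup>2 * (a\<^sup>2 + b\<^sup>2)" by simp
    moreover have "0 \<le> (norm r)\<^sup>2 + (norm s)\<^sup>2" by simp
    moreover have "y \<le> 0 \<and> z \<le> 0" if "y / 32 + z / 10 \<le> 0" "0 \<le> z" "0 \<le> y" for y z :: real
      using that by (intro conjI; linarith)
    ultimately have "(norm r)\<^sup>2 + (norm s)\<^sup>2 \<le> 0" and \<omega>: "\<omega>\<^sup>2 * (a\<^sup>2 + b\<^sup>2) \<le> 0"
      by blast+
    then have "r = 0" "s = 0" by (simp_all add: sum_power2_le_zero_iff)
    then have xv: "x = Complex a b *s cvec v"
      by (simp add: complex_vec_eq_iff r_def s_def)
    then have "Complex a b \<noteq> 0" using x by auto
    then have ab: "a\<^sup>2 + b\<^sup>2 \<noteq> 0" by (auto simp: sum_power2_eq_zero_iff complex_eq_iff)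
    have "0 \<le> a\<^sup>2 + b\<^sup>2" by simp
    then have "0 < a\<^sup>2 + b\<^sup>2" using ab by linarith
    then have "\<omega> = 0" using \<omega> by (simp add: mult_le_0_iff)
    then have "Y *v x = 0" using eq \<open>t = 1\<close> by simp
    then have "Complex a b *s (Y *v cvec v) = 0"
      unfolding xv by (simp add: vector_scalar_commute)
    then show "Y *v cvec v = 0" using \<open>Complex a b \<noteq> 0\<close> by simp
  qed
qed

section \<open>The nearest stable matrix\<close>

definition nearest :: "real ^ 'n ^ 'n" where "nearest = X - real_outer (X *v v) v"

lemma diff_nearest: "cmatrix X - cmatrix nearest = outer (cvec (X *v v)) (cvec v)"
  by (simp add: nearest_def cmatrix_diff cmatrix_real_outer)

lemma nearest_vector: "nearest *v p = X *v (p - (v \<bullet> p) *\<^sub>R v)"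
  by (simp add: nearest_def matrix_vector_mult_diff_rdistrib matrix_vector_mult_diff_distrib
      matrix_vector_mult_scaleR real_outer_vector)

text \<open>Pairing the eigenvalue equation with the projections \<open>r\<close>, \<open>s\<close>
  of the real and imaginary parts cancels Im z and leaves Re z (|r|^2 + |s|^2) \<le> - (|r|^2 +
  |s|^2) / 2. If Re z > 0, both projections vanish, so z x = 0, a contradiction.\<close>

lemma stable_nearest: "hurwitz_stable (cmatrix nearest)"
  unfolding hurwitz_stable_def
proof (intro allI impI)
  fix z assume "eigenvalue (cmatrix nearest) z"
  then obtain x where "x \<noteq> 0" and ev: "cmatrix nearest *v x = z *s x"
    by (auto simp: eigenvalue_def)
  define p where "p = re_vec x"
  define q where "q = im_vec x"
  define r where "r = p - (v \<bullet> p) *\<^sub>R v"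
  define s where "s = q - (v \<bullet> q) *\<^sub>R v"
  have r: "X *v r = Re z *\<^sub>R p - Im z *\<^sub>R q" and s: "X *v s = Re z *\<^sub>R q + Im z *\<^sub>R p"
    using ev by (simp_all add: complex_vec_eq_iff nearest_vector p_def q_def r_def s_def)
  have o: "v \<bullet> r = 0" "v \<bullet> s = 0"
    using norm_X_decompose(3) by (auto simp: r_def s_def)
  have p: "p = r + (v \<bullet> p) *\<^sub>R v" and q: "q = s + (v \<bullet> q) *\<^sub>R v" by (simp_all add: r_def s_def)
  have ip: "r \<bullet> p = (norm r)\<^sup>2" "s \<bullet> p = r \<bullet> s" "r \<bullet> q = r \<bullet> s" "s \<bullet> q = (norm s)\<^sup>2"
    using o by (subst p q, simp add: inner_add_right inner_commute dot_square_norm)+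
  show "Re z \<le> 0"
  proof (rule ccontr)
    assume z: "\<not> Re z \<le> 0"
    have "r \<bullet> (X *v r) + s \<bullet> (X *v s) = Re z * ((norm r)\<^sup>2 + (norm s)\<^sup>2)"
      unfolding r s by (simp add: inner_diff_right inner_add_right ip algebra_simps)
    then have "Re z * ((norm r)\<^sup>2 + (norm s)\<^sup>2) \<le> - (1/2) * ((norm r)\<^sup>2 + (norm s)\<^sup>2)"
      using inner_X_orthogonal[OF o(1)] inner_X_orthogonal[OF o(2)] by argo
    then have "(Re z + 1/2) * ((norm r)\<^sup>2 + (norm s)\<^sup>2) \<le> 0" by (simp add: algebra_simps)
    then have "(norm r)\<^sup>2 + (norm s)\<^sup>2 \<le> 0" using z by (simp add: mult_le_0_iff)
    then have "r = 0" "s = 0" by (simp_all add: sum_power2_le_zero_iff)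
    then have "re_vec (z *s x) = 0" "im_vec (z *s x) = 0"
      using r s by (simp_all add: p_def q_def)
    then have "z *s x = 0" by (simp add: complex_vec_eq_iff)
    then show False using z \<open>x \<noteq> 0\<close> by auto
  qed
qed

lemma norm_cmatrix_diff_nearest: "norm (cmatrix X - cmatrix nearest) = \<sigma>"
  by (simp add: diff_nearest norm_outer v \<sigma>_def)

text \<open>A stable \<open>Y\<close> within distance \<sigma> satisfies Y v = 0 by the equality
  case, so X - Y and X - \<open>nearest\<close> agree on \<open>v\<close>. The rank one part already
  uses up the whole norm \<sigma>, and Pythagoras leaves no room for anything else.\<close>

lemma frobenius_unique: "\<exists>!Y. frobenius_nearest_stable (cmatrix X) Y"
proof (rule ex1I)
  have unique: "Y = cmatrix nearest" if Y: "hurwitz_stable Y" "norm (cmatrix X - Y) \<le> \<sigma>" for Y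
  proof -
    define M where "M = cmatrix X - Y"
    obtain x where x: "norm x = 1" "norm (M *v x) \<le> \<sigma> \<Longrightarrow> Y *v cvec v = 0"
      using norm_residual_ge[OF Y(1)] unfolding M_def by metis
    have "norm (M *v x) \<le> \<sigma>"
      using norm_matrix_vector_mult_le[of M x] x(1) Y(2) by (simp add: M_def)
    then have Mv: "M *v cvec v = cvec (X *v v)"
      using x(2) by (simp add: M_def matrix_vector_mult_diff_rdistrib cmatrix_vector)
    have "(norm M)\<^sup>2 \<le> \<sigma>\<^sup>2" using Y(2) by (intro power_mono) (auto simp: M_def)
    then have "(norm (M - outer (cvec (X *v v)) (cvec v)))\<^sup>2 \<le> 0"
      using norm_diff_outer[of "cvec v" M] v by (simp add: Mv \<sigma>_def)
    then have "cmatrix X - Y = cmatrix X - cmatrix nearest"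
      unfolding diff_nearest by (simp add: M_def)
    then show ?thesis by simp
  qed
  show "frobenius_nearest_stable (cmatrix X) (cmatrix nearest)"
    unfolding frobenius_nearest_stable_def
  proof (intro conjI ballI)
    show "cmatrix nearest \<in> stable_matrices" using stable_nearest by (simp add: stable_matrices_def)
    fix Z :: "complex ^ 'n ^ 'n" assume "Z \<in> stable_matrices"
    then have Z: "hurwitz_stable Z" by (simp add: stable_matrices_def)
    \<comment> \<open>A stable matrix closer than \<sigma> would equal \<open>nearest\<close> by
      \<open>unique\<close>, yet \<open>nearest\<close> lies at distance exactly \<sigma>.\<close>
    show "norm (cmatrix X - cmatrix nearest) \<le> norm (cmatrix X - Z)"
      using unique[OF Z] norm_cmatrix_diff_nearest by fastforce
  qed
  show "Y = cmatrix nearest" if "frobenius_nearest_stable (cmatrix X) Y" for Y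
    using that unique[of Y] stable_nearest norm_cmatrix_diff_nearest
    by (auto simp: frobenius_nearest_stable_def stable_matrices_def)
qed

lemma uin_ge_stable:
  assumes \<nu>: "unitarily_invariant_norm \<nu>" and Y: "hurwitz_stable Y"
  shows "c_norm k \<nu> * \<sigma> \<le> \<nu> (cmatrix X - Y)"
proof -
  obtain x where x: "norm x = 1" "\<sigma> \<le> norm ((cmatrix X - Y) *v x)"
    using norm_residual_ge[OF Y] by metis
  have "c_norm k \<nu> * \<sigma> \<le> c_norm k \<nu> * norm ((cmatrix X - Y) *v x)"
    using x(2) uin_nonneg[OF \<nu>] by (intro mult_left_mono) (auto simp: c_norm_def)
  also have "\<dots> \<le> \<nu> (cmatrix X - Y)" by (rule uin_ge[OF \<nu> x(1)])
  finally show ?thesis .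
qed

lemma uin_nearest:
  assumes "unitarily_invariant_norm \<nu>"
  shows "\<nu> (cmatrix X - cmatrix nearest) = c_norm k \<nu> * \<sigma>"
  by (simp add: diff_nearest uin_outer[OF assms, of _ _ k] v \<sigma>_def)

text \<open>Stated for any set of stable matrices containing the real matrix \<open>nearest\<close>,
  so that the complex and the real minimum are both instances.\<close>

lemma distance:
  assumes \<nu>: "unitarily_invariant_norm \<nu>" and S: "cmatrix nearest \<in> S" "S \<subseteq> stable_matrices"
  shows "min_attained (\<lambda>Y. \<nu> (cmatrix X - Y)) S"
    and "(INF Y\<in>S. \<nu> (cmatrix X - Y)) = c_norm k \<nu> * sigma_min (cmatrix X)"
proof -
  have lower: "c_norm k \<nu> * \<sigma> \<le> \<nu> (cmatrix X - Y)" if "Y \<in> S" for Y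
    using that S(2) uin_ge_stable[OF \<nu>] by (auto simp: stable_matrices_def)
  then show "min_attained (\<lambda>Y. \<nu> (cmatrix X - Y)) S"
    using S(1) unfolding min_attained_def by (metis uin_nearest[OF \<nu>])
  have "(INF Y\<in>S. \<nu> (cmatrix X - Y)) = c_norm k \<nu> * \<sigma>"
    using S(1) lower by (intro cInf_eq_minimum) (auto simp: uin_nearest[OF \<nu>, symmetric] image_iff)
  then show "(INF Y\<in>S. \<nu> (cmatrix X - Y)) = c_norm k \<nu> * sigma_min (cmatrix X)"
    by (simp add: sigma_min_cmatrix[OF v min] \<sigma>_def)
qed

end

theorem theorem4p4:
  fixes k :: "'n::finite"
  assumes "CARD('n) \<ge> 2"
  shows "(\<forall>X\<in>U_ball k.
            \<not> hurwitz_stable (cmatrix X) \<and>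
            (\<forall>\<nu> :: complex ^ 'n ^ 'n \<Rightarrow> real. unitarily_invariant_norm \<nu> \<longrightarrow>
               min_attained (\<lambda>Y. \<nu> (cmatrix X - Y)) stable_matrices \<and>
               min_attained (\<lambda>Y. \<nu> (cmatrix X - Y)) (stable_matrices \<inter> real_matrices) \<and>
               dist_real \<nu> X = dist_complex \<nu> X \<and>
               dist_complex \<nu> X = c_norm k \<nu> * sigma_min (cmatrix X))) \<and>
         (AE X in lebesgue. X \<in> U_ball k \<longrightarrow>
            (\<exists>!Y. frobenius_nearest_stable (cmatrix X) Y))"
proof (intro conjI ballI)
  fix X assume X: "X \<in> U_ball k"
  show "\<not> hurwitz_stable (cmatrix X)" using X by (rule not_hurwitz_stable_U_ball)
  obtain v where "norm v = 1" "\<And>h. norm (X *v v) * norm h \<le> norm (X *v h)"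
    using exists_minimising_unit_vector by blast
  then interpret minimal_vector_near_D k X v using X by unfold_locales
  have "cmatrix nearest \<in> stable_matrices" "cmatrix nearest \<in> real_matrices"
    using stable_nearest by (auto simp: stable_matrices_def real_matrices_def)
  then show "\<forall>\<nu>. unitarily_invariant_norm \<nu> \<longrightarrow>
       min_attained (\<lambda>Y. \<nu> (cmatrix X - Y)) stable_matrices \<and>
       min_attained (\<lambda>Y. \<nu> (cmatrix X - Y)) (stable_matrices \<inter> real_matrices) \<and>
       dist_real \<nu> X = dist_complex \<nu> X \<and>
       dist_complex \<nu> X = c_norm k \<nu> * sigma_min (cmatrix X)"
    unfolding dist_real_def dist_complex_def using distance by auto
next
  have "\<exists>!Y. frobenius_nearest_stable (cmatrix X) Y" if X: "X \<in> U_ball k" for X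
  proof -
    obtain v where "norm v = 1" "\<And>h. norm (X *v v) * norm h \<le> norm (X *v h)"
      using exists_minimising_unit_vector by blast
    then interpret minimal_vector_near_D k X v using X by unfold_locales
    show ?thesis by (rule frobenius_unique)
  qed
  then show "AE X in lebesgue. X \<in> U_ball k \<longrightarrow> (\<exists>!Y. frobenius_nearest_stable (cmatrix X) Y)"
    by simp
qed

end
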